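(* Let $\alpha,\beta,\gamma,\delta$ be real numbers with $-\delta<-\gamma<-1<\alpha<\beta$. Then $$\mathsf{pdBW}_{-\delta}\subset \mathsf{pdBW}_{-\gamma}\subset \mathsf{pdBW}\supset \mathsf{pdBW}_{\alpha}\supset \mathsf{pdBW}_{\beta}$$ (inclusions not claimed to be proper).
   Context: A balancedly weighted vector space ($\mathsf{BW}$ space) $(X,\|\cdot\|)$ is a real topological vector space $X$ with a continuous map $\|\cdot\|:X\to[0,\infty)$ (the weight) such that $\|r\cdot\vec x\|=|r|\cdot\|\vec x\|$ for all $r\in\mathbb{R}$, $\vec x\in X$. The triangle inequality is not assumed. It is positive definite if $\|\vec x\|=0$ holds only for $\vec x=\vec 0$. Let $\mathsf{pdBW}$ be the class of all positive definite $\mathsf{BW}$ spaces. Let $(X,\|\cdot\|)\in\mathsf{pdBW}$ and $\varrho\in\mathbb{R}$. For $\vec x,\vec y\in X\setminus\{\vec 0\}$ put $\mathbf{s}=\left\|\frac{\vec x}{\|\vec x\|}+\frac{\vec y}{\|\vec y\|}\right\|$, $\mathbf{d}=\left\|\frac{\vec x}{\|\vec x\|}-\frac{\vec y}{\|\vec y\|}\right\|$, $\mathbf{\Sigma}=\mathbf{s}^2+\mathbf{d}^2$ (which is $>0$), $\mathbf{\Delta}=\mathbf{s}^2-\mathbf{d}^2$, and $\langle\vec x\,|\,\vec y\rangle_\varrho=\|\vec x\|\cdot\|\vec y\|\cdot\frac14\mathbf{\Delta}\cdot\left(\frac14\mathbf{\Sigma}\right)^{\varrho}$; put $\langle\vec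 x\,|\,\vec y\rangle_\varrho=0$ if $\vec x=\vec 0$ or $\vec y=\vec 0$. The space $(X,\|\cdot\|)$ "has the angle $\angle_\varrho$" if $|\langle\vec x\,|\,\vec y\rangle_\varrho|\le\|\vec x\|\cdot\|\vec y\|$ for all $\vec x,\vec y\in X$, i.e. if the angle $\angle_\varrho(\vec x,\vec y):=\arccos\frac{\langle\vec x|\vec y\rangle_\varrho}{\|\vec x\|\|\vec y\|}$ is defined for all $\vec x,\vec y\ne\vec 0$. Let $\mathsf{pdBW}_\varrho$ be the class of all $(X,\|\cdot\|)\in\mathsf{pdBW}$ that have the angle $\angle_\varrho$. *)

theory Defs
  imports "HOL-Analysis.Analysis"
begin

text \<open>
  A topological vector space is represented by its topology; the carrier is its
  \<^const>\<open>topspace\<close>, a linear subspace of an arbitrary ambient real vector space (possibly the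
  whole type). No separation axiom is part of the definition.
\<close>

definition real_tvs :: "'a::real_vector topology \<Rightarrow> bool" where
  "real_tvs X \<longleftrightarrow>
     subspace (topspace X) \<and>
     continuous_map (prod_topology X X) X (\<lambda>(x, y). x + y) \<and>
     continuous_map (prod_topology euclideanreal X) X (\<lambda>(r, x). r *\<^sub>R x)"

text \<open>A space together with its weight. Only the values of the weight on the carrier matter.\<close>

type_synonym 'a weighted = "'a topology \<times> ('a \<Rightarrow> real)"

definition BW :: "'a::real_vector weighted set" where
  "BW = {(X, N). real_tvs X \<and>
           continuous_map X (top_of_set {0..}) N \<and>
           (\<forall>r. \<forall>x\<in>topspace X. N (r *\<^sub>R x) = \<bar>r\<bar> * N x)}"

definition pdBW :: "'a::real_vector weighted set" where
  "pdBW = {(X, N). (X, N) \<in> BW \<and> (\<forall>x\<in>topspace X. N x = 0 \<longrightarrow> x = 0)}"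

definition bw_s :: "('a::real_vector \<Rightarrow> real) \<Rightarrow> 'a \<Rightarrow> 'a \<Rightarrow> real" where
  "bw_s N x y = N (x /\<^sub>R N x + y /\<^sub>R N y)"

definition bw_d :: "('a::real_vector \<Rightarrow> real) \<Rightarrow> 'a \<Rightarrow> 'a \<Rightarrow> real" where
  "bw_d N x y = N (x /\<^sub>R N x - y /\<^sub>R N y)"

definition bw_Sigma :: "('a::real_vector \<Rightarrow> real) \<Rightarrow> 'a \<Rightarrow> 'a \<Rightarrow> real" where
  "bw_Sigma N x y = (bw_s N x y)\<^sup>2 + (bw_d N x y)\<^sup>2"

definition bw_Delta :: "('a::real_vector \<Rightarrow> real) \<Rightarrow> 'a \<Rightarrow> 'a \<Rightarrow> real" where
  "bw_Delta N x y = (bw_s N x y)\<^sup>2 - (bw_d N x y)\<^sup>2"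

text \<open>
  For nonzero vectors of a positive definite space \<^const>\<open>bw_Sigma\<close> is positive, so that
  \<open>powr\<close> is the ordinary real power.
\<close>

definition bw_prod :: "real \<Rightarrow> ('a::real_vector \<Rightarrow> real) \<Rightarrow> 'a \<Rightarrow> 'a \<Rightarrow> real" where
  "bw_prod \<rho> N x y =
     (if x = 0 \<or> y = 0 then 0
      else N x * N y * (1/4 * bw_Delta N x y) * (1/4 * bw_Sigma N x y) powr \<rho>)"

definition has_angle :: "real \<Rightarrow> 'a::real_vector weighted \<Rightarrow> bool" where
  "has_angle \<rho> = (\<lambda>(X, N). \<forall>x\<in>topspace X. \<forall>y\<in>topspace X. \<bar>bw_prod \<rho> N x y\<bar> \<le> N x * N y)"

definition pdBW_angle :: "real \<Rightarrow> 'a::real_vector weighted set" where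
  "pdBW_angle \<rho> = {S \<in> pdBW. has_angle \<rho> S}"

end

theory Submission
  imports Defs
begin

text \<open>
  Write \<open>D = \<Delta>/4\<close> and \<open>S = \<Sigma>/4\<close> for a pair of nonzero vectors. The angle with exponent \<open>\<rho>\<close>
  exists exactly when \<open>\<bar>D\<bar> * S powr \<rho> \<le> 1\<close> for all such pairs. Since \<open>\<Delta>\<close> is the difference and
  \<open>\<Sigma>\<close> the sum of the same two squares, \<open>\<bar>D\<bar> \<le> S\<close>, so this bound always holds for \<open>\<rho> = -1\<close>.
  For a fixed pair the function \<open>\<rho> \<mapsto> \<bar>D\<bar> * S powr \<rho>\<close> is monotone, increasing or decreasing
  according to whether \<open>S\<close> is above or below 1, hence between \<open>-1\<close> and \<open>\<rho>\<close> it is bounded by the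
  larger of its two end values. Thus an angle with exponent \<open>\<rho>\<close> yields the angles with all
  exponents between \<open>-1\<close> and \<open>\<rho>\<close>, on whichever side of \<open>-1\<close> the number \<open>\<rho>\<close> lies. The two chains
  of inclusions are the two sides.
\<close>

lemma powr_le_max_endpoints:
  fixes S a b t :: real
  assumes "0 \<le> S" "a \<le> t" "t \<le> b"
  shows "S powr t \<le> max (S powr a) (S powr b)"
proof (cases "1 \<le> S")
  case True
  then have "S powr t \<le> S powr b"
    using assms by (intro powr_mono) auto
  then show ?thesis by simp
next
  case False
  then have "S powr t \<le> S powr a"
    using assms by (intro powr_mono') auto
  then show ?thesis by simp
qed

text \<open>
  The exponent \<open>-1\<close> is the one at which the bound is automatic, so only the bound at the other
  end has to be assumed.
\<close>

lemma abs_mult_powr_le_one_between: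
  fixes D S \<rho> t :: real
  assumes "\<bar>D\<bar> \<le> S" and bound: "\<bar>D\<bar> * S powr \<rho> \<le> 1"
    and between: "-1 \<le> t \<and> t \<le> \<rho> \<or> \<rho> \<le> t \<and> t \<le> -1"
  shows "\<bar>D\<bar> * S powr t \<le> 1"
proof -
  have "0 \<le> S" using assms(1) by linarith
  then have "S powr t \<le> max (S powr (-1)) (S powr \<rho>)"
    using between powr_le_max_endpoints[of S "-1" t \<rho>] powr_le_max_endpoints[of S \<rho> t "-1"]
    by (auto simp: max.commute)
  then have "\<bar>D\<bar> * S powr t \<le> \<bar>D\<bar> * max (S powr (-1)) (S powr \<rho>)"
    by (simp add: mult_left_mono)
  moreover have "\<bar>D\<bar> * S powr (-1) \<le> 1"
    using \<open>0 \<le> S\<close> assms(1) by (cases "S = 0") (auto simp: powr_minus field_simps)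
  ultimately show ?thesis
    using bound by (auto simp: max_def split: if_splits)
qed

lemma abs_bw_Delta_le_bw_Sigma: "\<bar>bw_Delta N x y\<bar> \<le> bw_Sigma N x y"
  unfolding bw_Delta_def bw_Sigma_def
  using zero_le_power2[of "bw_s N x y"] zero_le_power2[of "bw_d N x y"] by linarith

lemma pdBW_weight_pos:
  assumes "(X, N) \<in> pdBW" "x \<in> topspace X" "x \<noteq> 0"
  shows "0 < N x"
proof -
  have "continuous_map X (top_of_set {0..}) N"
    using assms(1) by (simp add: pdBW_def BW_def)
  then have "0 \<le> N x"
    using assms(2) by (auto simp: continuous_map_in_subtopology)
  moreover have "N x \<noteq> 0"
    using assms by (auto simp: pdBW_def)
  ultimately show ?thesis by simp
qed

text \<open>
  The weights of the two vectors are positive and cancel, which leaves an inequality for a single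
  pair \<open>D\<close>, \<open>S\<close>.
\<close>

lemma abs_bw_prod_le_iff:
  assumes "(X, N) \<in> pdBW" "x \<in> topspace X" "y \<in> topspace X" "x \<noteq> 0" "y \<noteq> 0"
  shows "\<bar>bw_prod \<rho> N x y\<bar> \<le> N x * N y \<longleftrightarrow>
    \<bar>1/4 * bw_Delta N x y\<bar> * (1/4 * bw_Sigma N x y) powr \<rho> \<le> 1"
proof -
  have pos: "0 < N x" "0 < N y"
    using assms pdBW_weight_pos by blast+
  have "\<bar>bw_prod \<rho> N x y\<bar> =
      (N x * N y) * (\<bar>1/4 * bw_Delta N x y\<bar> * (1/4 * bw_Sigma N x y) powr \<rho>)"
    using assms(4,5) pos by (simp add: bw_prod_def abs_mult)
  then show ?thesis
    using mult_le_cancel_left_pos[of "N x * N y" _ 1] pos by (simp only: mult_pos_pos mult_1_right)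
qed

lemma pdBW_angle_mono_between:
  assumes between: "-1 \<le> t \<and> t \<le> \<rho> \<or> \<rho> \<le> t \<and> t \<le> -1"
  shows "pdBW_angle \<rho> \<subseteq> (pdBW_angle t :: 'a::real_vector weighted set)"
proof
  fix S :: "'a weighted"
  assume S: "S \<in> pdBW_angle \<rho>"
  obtain X N where S_eq: "S = (X, N)" by (cases S)
  have pd: "(X, N) \<in> pdBW" and ang: "has_angle \<rho> (X, N)"
    using S by (auto simp: pdBW_angle_def S_eq)
  have "\<bar>bw_prod t N x y\<bar> \<le> N x * N y" if xy: "x \<in> topspace X" "y \<in> topspace X" for x y
  proof (cases "x = 0 \<or> y = 0")
    case True
    \<comment> \<open>Both products are 0 by convention, whatever the exponent.\<close>
    then have "bw_prod t N x y = bw_prod \<rho> N x y"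
      by (simp add: bw_prod_def)
    then show ?thesis
      using ang xy by (simp add: has_angle_def)
  next
    case False
    then have nz: "x \<noteq> 0" "y \<noteq> 0" by auto
    have "\<bar>1/4 * bw_Delta N x y\<bar> * (1/4 * bw_Sigma N x y) powr \<rho> \<le> 1"
      using ang xy by (simp only: has_angle_def prod.case abs_bw_prod_le_iff[OF pd xy nz, symmetric])
    moreover have "\<bar>1/4 * bw_Delta N x y\<bar> \<le> 1/4 * bw_Sigma N x y"
      using abs_bw_Delta_le_bw_Sigma[of N x y] by simp
    ultimately show ?thesis
      using abs_mult_powr_le_one_between between abs_bw_prod_le_iff[OF pd xy nz] by blast
  qed
  then show "S \<in> pdBW_angle t"
    using pd by (simp add: pdBW_angle_def has_angle_def S_eq)
qed

theorem theorem1: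
  fixes \<alpha> \<beta> \<gamma> \<delta> :: real
  assumes "- \<delta> < - \<gamma>" and "- \<gamma> < - 1" and "- 1 < \<alpha>" and "\<alpha> < \<beta>"
  shows "(pdBW_angle (- \<delta>) :: 'a::real_vector weighted set) \<subseteq> pdBW_angle (- \<gamma>) \<and>
         (pdBW_angle (- \<gamma>) :: 'a weighted set) \<subseteq> pdBW \<and>
         (pdBW :: 'a weighted set) \<supseteq> pdBW_angle \<alpha> \<and>
         (pdBW_angle \<alpha> :: 'a weighted set) \<supseteq> pdBW_angle \<beta>"
proof -
  have "(pdBW_angle \<rho> :: 'a weighted set) \<subseteq> pdBW" for \<rho>
    by (auto simp: pdBW_angle_def)
  moreover have "(pdBW_angle (- \<delta>) :: 'a weighted set) \<subseteq> pdBW_angle (- \<gamma>)"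
    using assms by (intro pdBW_angle_mono_between) auto
  moreover have "(pdBW_angle \<beta> :: 'a weighted set) \<subseteq> pdBW_angle \<alpha>"
    using assms by (intro pdBW_angle_mono_between) auto
  ultimately show ?thesis by blast
qed

end
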